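(* Let $\varepsilon > 0$ be a sufficiently small constant. Any streaming algorithm (even randomized) which, given $A \in \mathbb{R}^{n\times d}$ and $b \in \mathbb{R}^n$ whose rows $(A_i, b_i)$ arrive one at a time, outputs a solution to the $\ell_\infty$-regression problem $\min_{x}\|Ax-b\|_\infty$ with error at most $\varepsilon\|b\|_\infty$ relative to the optimum requires $\min\{n, 2^{\Omega(d)}\}$ space.
   Context: $\|v\|_\infty = \max_i |v_i|$. Space is measured as the memory used by the streaming algorithm. *)

theory Defs
  imports "HOL-Probability.Probability_Measure" "Jordan_Normal_Form.Matrix"
begin

hide_type (open) Finite_Cartesian_Product.vec
hide_const (open) Finite_Cartesian_Product.vec Finite_Cartesian_Product.row

text \<open>Meaningful for vectors of positive dimension only.\<close>

definition linf_norm :: "real vec \<Rightarrow> real" where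
  "linf_norm v = Max (abs ` set\<^sub>v v)"

definition linf_regression_opt :: "real mat \<Rightarrow> real vec \<Rightarrow> real" where
  "linf_regression_opt A b = (INF x\<in>carrier_vec (dim_col A). linf_norm (A *\<^sub>v x - b))"

definition linf_regression_approx :: "real \<Rightarrow> real mat \<Rightarrow> real vec \<Rightarrow> real vec \<Rightarrow> bool" where
  "linf_regression_approx \<epsilon> A b x \<longleftrightarrow>
     x \<in> carrier_vec (dim_col A) \<and>
     linf_norm (A *\<^sub>v x - b) \<le> linf_regression_opt A b + \<epsilon> * linf_norm b"

text \<open>
  The memory of a streaming algorithm is a bit string. The random tape and the position in the
  stream may be read at any time and are not charged as space. This makes lower bounds stronger
  and covers algorithms tossing fresh private coins at every step. No computability is required,
  and an algorithm may depend on all parameters of the problem (it is a separate object for each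
  dimension and each accuracy). A deterministic algorithm is one that ignores its tape.
\<close>

type_synonym tape = "nat \<Rightarrow> bool"

record streaming_alg =
  start :: "tape \<Rightarrow> bool list"
  process :: "tape \<Rightarrow> nat \<Rightarrow> bool list \<Rightarrow> real vec \<times> real \<Rightarrow> bool list"
  answer :: "tape \<Rightarrow> bool list \<Rightarrow> real vec"

primrec memory_after ::
    "streaming_alg \<Rightarrow> tape \<Rightarrow> real mat \<Rightarrow> real vec \<Rightarrow> nat \<Rightarrow> bool list" where
  "memory_after \<A> \<omega> A b 0 = start \<A> \<omega>"
| "memory_after \<A> \<omega> A b (Suc i) =
     process \<A> \<omega> i (memory_after \<A> \<omega> A b i) (row A i, vec_index b i)"

definition run :: "streaming_alg \<Rightarrow> tape \<Rightarrow> real mat \<Rightarrow> real vec \<Rightarrow> real vec" where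
  "run \<A> \<omega> A b = answer \<A> \<omega> (memory_after \<A> \<omega> A b (dim_row A))"

text \<open>
  The set \<open>D\<close> collects the numbers allowed as entries of the input; \<open>D = UNIV\<close> is the problem on
  all of \<open>\<real>\<^sup>n\<^sup>\<times>\<^sup>d \<times> \<real>\<^sup>n\<close>, while a finite \<open>D\<close> models entries of bounded precision.
  For \<open>D = UNIV\<close> alone a space bound would be degenerate: no algorithm with bounded memory solves
  that problem, since already for \<open>n = d = 1\<close> an arbitrary real ratio has to be remembered.
\<close>

definition regression_inputs :: "real set \<Rightarrow> nat \<Rightarrow> nat \<Rightarrow> (real mat \<times> real vec) set" where
  "regression_inputs D n d =
     {(A, b). A \<in> carrier_mat n d \<and> b \<in> carrier_vec n \<and> elements_mat A \<subseteq> D \<and> set\<^sub>v b \<subseteq> D}"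

text \<open>
  Success probability \<open>2/3\<close> on every fixed input. Since \<^const>\<open>measure\<close> is \<open>0\<close> on non-measurable
  sets, the inequality includes measurability of the success event.
\<close>

definition solves_linf_regression ::
    "tape measure \<Rightarrow> streaming_alg \<Rightarrow> real set \<Rightarrow> nat \<Rightarrow> nat \<Rightarrow> real \<Rightarrow> bool" where
  "solves_linf_regression P \<A> D n d \<epsilon> \<longleftrightarrow>
     (\<forall>(A, b)\<in>regression_inputs D n d.
        measure P {\<omega>\<in>space P. linf_regression_approx \<epsilon> A b (run \<A> \<omega> A b)} \<ge> 2 / 3)"

definition space_at_most ::
    "tape measure \<Rightarrow> streaming_alg \<Rightarrow> real set \<Rightarrow> nat \<Rightarrow> nat \<Rightarrow> nat \<Rightarrow> bool" where
  "space_at_most P \<A> D n d s \<longleftrightarrow>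
     (\<forall>(A, b)\<in>regression_inputs D n d. \<forall>\<omega>\<in>space P. \<forall>i\<le>n.
        length (memory_after \<A> \<omega> A b i) \<le> s)"

end

theory Submission
  imports Defs
begin

unbundle no vec_syntax and no inner_syntax

text \<open>
  Reduction from the communication problem INDEX over an alphabet of 64 symbols. Take sign vectors
  \<open>v\<^sub>i\<close> with pairwise inner products at most \<open>d / 2\<close> in absolute value; greedily one finds
  \<open>2\<^sup>\<Omega>\<^sup>(\<^sup>d\<^sup>)\<close> of them. Alice streams the rows \<open>(v\<^sub>i, u\<^sub>i)\<close> with \<open>u\<^sub>i < 64\<close>, and Bob, who wants
  \<open>u\<^sub>j\<close>, appends \<open>(v\<^sub>j, W)\<close> with \<open>W = 448 = 7 * 64\<close>. The two conflicting requirements on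
  \<open>v\<^sub>j \<bullet> x\<close> dominate all other rows: the optimum is \<open>(W - u\<^sub>j) / 2\<close>, attained at the multiple
  of \<open>v\<^sub>j\<close> with \<open>v\<^sub>j \<bullet> x = (W + u\<^sub>j) / 2\<close>, and every solution of error \<open>\<epsilon> W\<close> has
  \<open>v\<^sub>j \<bullet> x\<close> within \<open>\<epsilon> W\<close> of this value and so reveals \<open>u\<^sub>j\<close>. The alphabet
  is chosen so large that a single row accounts for at least two bits of memory, which pays for
  Bob's row and yields the constant 1 in front of \<open>n\<close>.
\<close>

section \<open>Exponentially large codes with balanced distances\<close>

text \<open>The neighbourhoods of a maximal independent set \<open>C\<close> cover
  \<open>\<Omega>\<close>: a point outside all of them could be added to \<open>C\<close>. Each has
  at most \<open>V\<close> points. Reflexivity puts the points of \<open>C\<close> into their own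
  neighbourhoods.\<close>

lemma exists_large_independent_set:
  assumes "finite \<Omega>" and "\<And>x. x \<in> \<Omega> \<Longrightarrow> R x x"
    and sym: "\<And>x y. R x y \<Longrightarrow> R y x"
    and deg: "\<And>x. x \<in> \<Omega> \<Longrightarrow> card {y\<in>\<Omega>. R x y} \<le> V"
  shows "\<exists>C\<subseteq>\<Omega>. (\<forall>x\<in>C. \<forall>y\<in>C. x \<noteq> y \<longrightarrow> \<not> R x y) \<and> card \<Omega> \<le> card C * V"
proof -
  define I where "I = {C. C \<subseteq> \<Omega> \<and> (\<forall>x\<in>C. \<forall>y\<in>C. x \<noteq> y \<longrightarrow> \<not> R x y)}"
  have "finite I" "I \<noteq> {}"
    using \<open>finite \<Omega>\<close> by (auto simp: I_def)
  then obtain C where C: "C \<in> I" and max: "\<And>C'. C' \<in> I \<Longrightarrow> C \<subseteq> C' \<Longrightarrow> C = C'"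
    using finite_has_maximal by metis
  have "y \<in> (\<Union>x\<in>C. {y\<in>\<Omega>. R x y})" if "y \<in> \<Omega>" for y
  proof (rule ccontr)
    assume *: "\<not> ?thesis"
    then have "insert y C \<in> I"
      using C that sym by (auto simp: I_def)
    with max[of "insert y C"] have "y \<in> C" by auto
    with * assms(2) that show False by auto
  qed
  then have "card \<Omega> \<le> card (\<Union>x\<in>C. {y\<in>\<Omega>. R x y})"
    using C assms(1) by (intro card_mono) (auto simp: I_def intro: finite_subset)
  also have "\<dots> \<le> (\<Sum>x\<in>C. card {y\<in>\<Omega>. R x y})"
    using C assms(1) by (intro card_UN_le) (auto simp: I_def intro: finite_subset)
  also have "\<dots> \<le> (\<Sum>x\<in>C. V)"
    using C deg by (intro sum_mono) (auto simp: I_def)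
  finally show ?thesis
    using C by (auto simp: I_def)
qed

lemma sum_power_card_Pow:
  fixes a :: real
  assumes "finite A"
  shows "(\<Sum>Z\<in>Pow A. a ^ card Z) = (1 + a) ^ card A"
  using prod_add[OF assms, of "\<lambda>_. a" "\<lambda>_. 1"] by (simp add: add.commute)

text \<open>Exponential weighting as in a Chernoff bound: give \<open>Z\<close> the weight
  \<open>(1 / 4) ^ card Z\<close>. All weights together make \<open>(5 / 4) ^ d\<close>, and a set
  of size below \<open>d / 4\<close> weighs at least \<open>(1 / 4) powr (d / 4)\<close>, which is
  \<open>(1 / sqrt 2) ^ d\<close>.\<close>

lemma card_small_subsets_le:
  "real (card {Z\<in>Pow {..<d}. 4 * card Z < d}) \<le> (5 / 4 * sqrt 2) ^ d"
proof -
  let ?S = "{Z\<in>Pow {..<d}. 4 * card Z < d}"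
  have root: "(1 / sqrt 2) ^ d \<le> (1 / 4) ^ k" if "4 * k < d" for k
  proof -
    have "(1 / sqrt 2) ^ d \<le> (1 / sqrt 2) ^ (4 * k)"
      using that by (intro power_decreasing) auto
    also have "\<dots> = (((1 / sqrt 2)\<^sup>2)\<^sup>2) ^ k"
      by (simp flip: power_mult)
    also have "\<dots> = (1 / 4) ^ k"
      by (simp add: power_divide)
    finally show ?thesis .
  qed
  have "card ?S * (1 / sqrt 2) ^ d = (\<Sum>Z\<in>?S. (1 / sqrt 2) ^ d)"
    by simp
  also have "\<dots> \<le> (\<Sum>Z\<in>?S. (1 / 4) ^ card Z)"
    by (intro sum_mono root) auto
  also have "\<dots> \<le> (\<Sum>Z\<in>Pow {..<d}. (1 / 4) ^ card Z)"
    by (intro sum_mono2) auto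
  also have "\<dots> = (5 / 4) ^ d"
    by (simp add: sum_power_card_Pow)
  finally show ?thesis
    by (simp add: power_divide power_mult_distrib field_simps)
qed

lemma inj_on_sym_diff: "inj_on (sym_diff X) S"
  by (rule inj_onI) blast

text \<open>The map \<open>sym_diff X\<close> is injective, so it suffices to count the differences.
  Those of size above \<open>3 * d / 4\<close> are complements of those of size below
  \<open>d / 4\<close>, whence the factor 2.\<close>

lemma card_unbalanced_sym_diff_le:
  assumes "X \<subseteq> {..<d}"
  shows "real (card {Y\<in>Pow {..<d}. 4 * card (sym_diff X Y) < d \<or> 3 * d < 4 * card (sym_diff X Y)})
    \<le> 2 * (5 / 4 * sqrt 2) ^ d"
proof -
  let ?S = "{Z\<in>Pow {..<d}. 4 * card Z < d}"
  let ?T = "{Y\<in>Pow {..<d}. 4 * card (sym_diff X Y) < d \<or> 3 * d < 4 * card (sym_diff X Y)}"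
  have "sym_diff X ` ?T \<subseteq> ?S \<union> (\<lambda>Z. {..<d} - Z) ` ?S"
  proof safe
    fix Y assume Y: "Y \<subseteq> {..<d}" "3 * d < 4 * card (sym_diff X Y)"
      and n: "sym_diff X Y \<notin> (\<lambda>Z. {..<d} - Z) ` ?S"
    have *: "card ({..<d} - sym_diff X Y) = d - card (sym_diff X Y)"
      using assms Y by (subst card_Diff_subset) (auto intro: finite_subset[of _ "{..<d}"])
    have "sym_diff X Y = {..<d} - ({..<d} - sym_diff X Y)" using assms Y by blast
    moreover have "card (sym_diff X Y) \<le> card {..<d}"
      using assms Y by (intro card_mono) auto
    then have "{..<d} - sym_diff X Y \<in> ?S" using * Y(2) by simp
    ultimately have False using n by (metis (no_types, lifting) image_eqI)
    then show "4 * card (sym_diff X Y) < d" ..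
  qed (use assms in auto)
  then have "card (sym_diff X ` ?T) \<le> card (?S \<union> (\<lambda>Z. {..<d} - Z) ` ?S)"
    by (intro card_mono) auto
  also have "\<dots> \<le> card ?S + card ((\<lambda>Z. {..<d} - Z) ` ?S)"
    by (rule card_Un_le)
  also have "\<dots> \<le> card ?S + card ?S"
    by (intro add_left_mono card_image_le) auto
  finally have "card ?T \<le> 2 * card ?S"
    by (simp add: card_image[OF inj_on_sym_diff])
  then show ?thesis
    using card_small_subsets_le[of d] by linarith
qed

text \<open>Gilbert-Varshamov argument: words are in conflict if their distance is unbalanced, and a
  maximal conflict-free family has at least \<open>2 ^ d / V\<close> members. For sign vectors,
  distances between \<open>d / 4\<close> and \<open>3 * d / 4\<close> mean inner products of
  absolute value at most \<open>d / 2\<close>.\<close>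

lemma exists_balanced_code:
  "\<exists>C\<subseteq>Pow {..<d}. 2 powr (real d / 8) \<le> 2 * card C \<and>
     (\<forall>X\<in>C. \<forall>Y\<in>C. X \<noteq> Y \<longrightarrow> d \<le> 4 * card (sym_diff X Y) \<and> 4 * card (sym_diff X Y) \<le> 3 * d)"
proof (cases "d = 0")
  \<comment> \<open>Handled apart because the conflict relation \<open>R\<close> below is not
    reflexive for \<open>d = 0\<close>.\<close>
  case True
  then show ?thesis by (intro exI[of _ "{{}}"]) auto
next
  case False
  define R where "R X Y \<longleftrightarrow> 4 * card (sym_diff X Y) < d \<or> 3 * d < 4 * card (sym_diff X Y)" for X Y :: "nat set"
  define V where "V = nat \<lfloor>2 * (5 / 4 * sqrt 2) ^ d\<rfloor>"
  have "\<exists>C\<subseteq>Pow {..<d}. (\<forall>X\<in>C. \<forall>Y\<in>C. X \<noteq> Y \<longrightarrow> \<not> R X Y) \<and> card (Pow {..<d}) \<le> card C * V"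
  proof (rule exists_large_independent_set)
    show "card {Y\<in>Pow {..<d}. R X Y} \<le> V" if "X \<in> Pow {..<d}" for X
      unfolding R_def V_def using card_unbalanced_sym_diff_le[of X d] that
      by (intro le_nat_floor) auto
    show "R X Y \<Longrightarrow> R Y X" for X Y by (simp add: R_def Un_commute)
    show "R X X" for X using False by (simp add: R_def)
  qed simp
  then obtain C where C: "C \<subseteq> Pow {..<d}" "\<forall>X\<in>C. \<forall>Y\<in>C. X \<noteq> Y \<longrightarrow> \<not> R X Y"
    and "card (Pow {..<d}) \<le> card C * V" by blast
  then have "2 ^ d \<le> card C * V"
    by (simp add: card_Pow)
  then have "real (2 ^ d) \<le> real (card C * V)"
    by (simp only: of_nat_le_iff)
  also have "\<dots> \<le> card C * (2 * (5 / 4 * sqrt 2) ^ d)"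
    unfolding V_def of_nat_mult by (intro mult_left_mono) (auto simp: of_nat_nat)
  finally have "2 ^ d \<le> card C * (2 * (5 / 4 * sqrt 2) ^ d)" by simp
  moreover have "2 powr (real d / 8) * (5 / 4 * sqrt 2) ^ d \<le> 2 ^ d"
  proof -
    \<comment> \<open>This is where the rate 1/8 comes from: eighth powers clear both roots and
      leave \<open>(5 / 4) ^ 8 \<le> 8\<close>.\<close>
    have "(2 powr (1 / 8) * (5 / 4 * sqrt 2)) ^ 8 \<le> (2::real) ^ 8"
    proof -
      have "(2 powr (1 / 8)) ^ 8 = (2::real)"
        by (simp flip: powr_realpow add: powr_powr)
      moreover have "sqrt 2 ^ 8 = (16::real)"
        using power_mult[of "sqrt 2" 2 4] by simp
      ultimately show ?thesis by (simp add: power_mult_distrib power_divide)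
    qed
    then have "2 powr (1 / 8) * (5 / 4 * sqrt 2) \<le> (2::real)"
      by (rule power_le_imp_le_base[of _ 7, simplified]) simp
    then have "(2 powr (1 / 8) * (5 / 4 * sqrt 2)) ^ d \<le> (2::real) ^ d"
      by (intro power_mono) auto
    moreover have "(2 powr (1 / 8)) ^ d = 2 powr (real d / 8)"
      by (simp flip: powr_realpow add: powr_powr)
    ultimately show ?thesis by (simp only: power_mult_distrib)
  qed
  ultimately have "2 powr (real d / 8) * (5 / 4 * sqrt 2) ^ d \<le> card C * (2 * (5 / 4 * sqrt 2) ^ d)"
    by linarith
  then have "2 powr (real d / 8) * (5 / 4 * sqrt 2) ^ d \<le> (2 * real (card C)) * (5 / 4 * sqrt 2) ^ d"
    by (simp only: mult_ac)
  then have "2 powr (real d / 8) \<le> 2 * card C"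
    by (subst (asm) mult_le_cancel_right_pos) auto
  with C show ?thesis
    by (intro exI[of _ C]) (simp add: R_def not_less)
qed

section \<open>Sign vectors and residuals of approximate solutions\<close>

definition sign_vec :: "nat \<Rightarrow> nat set \<Rightarrow> real vec" where
  "sign_vec d X = Matrix.vec d (\<lambda>k. if k \<in> X then 1 else - 1)"

lemma sign_vec_carrier [simp]: "sign_vec d X \<in> carrier_vec d"
  by (simp add: sign_vec_def)

lemma dim_sign_vec [simp]: "dim_vec (sign_vec d X) = d"
  by (simp add: sign_vec_def)

lemma scalar_prod_sign_vec:
  assumes "X \<subseteq> {..<d}" "Y \<subseteq> {..<d}"
  shows "sign_vec d X \<bullet> sign_vec d Y = real d - 2 * real (card (sym_diff X Y))"
proof -
  have "sign_vec d X \<bullet> sign_vec d Y = (\<Sum>k<d. 1 - 2 * indicator (sym_diff X Y) k)"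
    unfolding scalar_prod_def sign_vec_def
    by (auto simp: atLeast0LessThan indicator_def intro!: sum.cong)
  also have "\<dots> = real d - 2 * (\<Sum>k<d. indicator (sym_diff X Y) k)"
    by (simp add: sum_subtractf sum_distrib_left)
  also have "(\<Sum>k<d. indicator (sym_diff X Y) k) = real (card (sym_diff X Y))"
    unfolding indicator_def using assms
    by (subst sum_of_bool_eq) (auto intro!: arg_cong[where f=card])
  finally show ?thesis .
qed

lemma linf_norm_le_iff:
  assumes "dim_vec v > 0"
  shows "linf_norm v \<le> r \<longleftrightarrow> (\<forall>i<dim_vec v. \<bar>v $ i\<bar> \<le> r)"
proof -
  have *: "set\<^sub>v v = (\<lambda>i. v $ i) ` {..<dim_vec v}"
    by (auto simp: vec_set_def)
  show ?thesis
    unfolding linf_norm_def * using assms by (subst Max_le_iff) auto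
qed

lemma linf_norm_nonneg:
  assumes "dim_vec v > 0"
  shows "0 \<le> linf_norm v"
  using linf_norm_le_iff[OF assms, of "linf_norm v"] assms abs_ge_zero order_trans by blast

text \<open>Any feasible \<open>z\<close> bounds the optimum from above, so the exact optimum never
  has to be computed. The infimum is over a set bounded below by 0.\<close>

lemma linf_regression_approx_residual:
  assumes A: "A \<in> carrier_mat n d" and b: "b \<in> carrier_vec n" and "0 \<le> \<epsilon>"
    and z: "z \<in> carrier_vec d" "\<And>i. i < n \<Longrightarrow> \<bar>row A i \<bullet> z - b $ i\<bar> \<le> r"
    and B: "\<And>i. i < n \<Longrightarrow> \<bar>b $ i\<bar> \<le> B"
    and x: "linf_regression_approx \<epsilon> A b x" and "i < n"
  shows "\<bar>row A i \<bullet> x - b $ i\<bar> \<le> r + \<epsilon> * B"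
proof -
  have "linf_regression_opt A b \<le> linf_norm (A *\<^sub>v z - b)"
    unfolding linf_regression_opt_def using assms
    by (intro cINF_lower bdd_belowI2[of _ 0] linf_norm_nonneg) auto
  also have "\<dots> \<le> r"
    using assms by (subst linf_norm_le_iff) auto
  finally have "linf_regression_opt A b \<le> r" .
  moreover have "linf_norm b \<le> B"
    using assms by (subst linf_norm_le_iff) auto
  then have "\<epsilon> * linf_norm b \<le> \<epsilon> * B"
    using \<open>0 \<le> \<epsilon>\<close> by (rule mult_left_mono)
  ultimately have "linf_norm (A *\<^sub>v x - b) \<le> r + \<epsilon> * B"
    using x unfolding linf_regression_approx_def by linarith
  then show ?thesis
    using assms by (subst (asm) linf_norm_le_iff) auto
qed

section \<open>Memory as a one-way message\<close>

text \<open>Causality: the state after Alice's rows cannot depend on Bob's index.\<close>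

lemma memory_after_cong_prefix:
  assumes "\<And>k. k < i \<Longrightarrow> row A k = row A' k" "\<And>k. k < i \<Longrightarrow> b $ k = b' $ k"
  shows "memory_after \<A> \<omega> A b i = memory_after \<A> \<omega> A' b' i"
  using assms by (induction i) auto

text \<open>Earlier rows influence the rest of the run only through the stored state, which
  therefore serves as Alice's message.\<close>

lemma memory_after_cong_suffix:
  assumes "memory_after \<A> \<omega> A b m = memory_after \<A> \<omega> A' b' m" and "m \<le> n"
    and "\<And>k. m \<le> k \<Longrightarrow> k < n \<Longrightarrow> row A k = row A' k"
    and "\<And>k. m \<le> k \<Longrightarrow> k < n \<Longrightarrow> b $ k = b' $ k"
  shows "memory_after \<A> \<omega> A b n = memory_after \<A> \<omega> A' b' n"
  using assms(2,1,3,4) by (induction n rule: dec_induct) auto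

section \<open>Lower bound for INDEX\<close>

lemma card_bool_lists_le: "card {m :: bool list. length m \<le> s} \<le> 2 ^ (s + 1)"
proof -
  have "card {m :: bool list. length m \<le> s} = (\<Sum>i\<le>s. 2 ^ i)"
    using card_lists_length_le[of "UNIV :: bool set" s] by simp
  also have "\<dots> \<le> 2 ^ (s + 1)"
    by (induction s) auto
  finally show ?thesis .
qed

lemma finite_bool_lists: "finite {m :: bool list. length m \<le> s}"
  using finite_lists_length_le[of "UNIV :: bool set" s] by simp

text \<open>Averaging: the expected number of events that occur is at least
  \<open>p * card I\<close>, so some outcome reaches it. This fixes the random tape.\<close>

lemma (in prob_space) exists_many_events:
  assumes "finite I" "\<And>i. i \<in> I \<Longrightarrow> E i \<in> events" "\<And>i. i \<in> I \<Longrightarrow> p \<le> prob (E i)"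
  shows "\<exists>\<omega>\<in>space M. p * card I \<le> (\<Sum>i\<in>I. indicator (E i) \<omega>)"
proof (rule ccontr)
  assume *: "\<not> ?thesis"
  have int: "integrable M (\<lambda>\<omega>. \<Sum>i\<in>I. indicator (E i) \<omega> :: real)"
    using assms by (intro Bochner_Integration.integrable_sum integrable_real_indicator)
      (auto simp: emeasure_eq_measure)
  have "expectation (\<lambda>\<omega>. \<Sum>i\<in>I. indicator (E i) \<omega>) < p * card I"
    using * by (intro expectation_less int) (auto intro!: AE_I2 simp: not_le)
  moreover have "expectation (\<lambda>\<omega>. \<Sum>i\<in>I. indicator (E i) \<omega>) = (\<Sum>i\<in>I. prob (E i))"
    using assms by (subst Bochner_Integration.integral_sum)
      (auto simp: emeasure_eq_measure intro!: sum.cong integrable_real_indicator)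
  moreover have "(\<Sum>i\<in>I. p) \<le> (\<Sum>i\<in>I. prob (E i))"
    using assms by (intro sum_mono)
  ultimately show False by (simp add: mult.commute)
qed

text \<open>
  For a fixed tape and a fixed memory state \<open>m\<close>, the decoded symbols do not depend on \<open>u\<close>, so the
  sum of \<open>q\<close> to the number of correctly decoded positions factorizes over the positions. Jensen's
  inequality (through the tangent of \<open>exp\<close>) bounds the same sum from below.
\<close>

lemma index_lower_bound:
  fixes q N :: nat and E :: "(nat \<Rightarrow> nat) \<Rightarrow> nat \<Rightarrow> 'w set" and mem :: "'w \<Rightarrow> (nat \<Rightarrow> nat) \<Rightarrow> 'm"
  defines "U \<equiv> {..<N} \<rightarrow>\<^sub>E {..<q}"
  assumes "prob_space P" and "0 < q" and "finite S"
    and prob: "\<And>u j. u \<in> U \<Longrightarrow> j < N \<Longrightarrow> 2 / 3 \<le> measure P (E u j)"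
    and mem: "\<And>\<omega> u. \<omega> \<in> space P \<Longrightarrow> u \<in> U \<Longrightarrow> mem \<omega> u \<in> S"
    and decode: "\<And>\<omega> u u' j. \<omega> \<in> E u j \<Longrightarrow> \<omega> \<in> E u' j \<Longrightarrow> \<omega> \<in> space P \<Longrightarrow> u \<in> U \<Longrightarrow> u' \<in> U \<Longrightarrow>
        j < N \<Longrightarrow> mem \<omega> u = mem \<omega> u' \<Longrightarrow> u j = u' j"
  shows "real q powr (2 / 3 * N) \<le> real (card S) * 2 ^ N"
proof -
  interpret prob_space P by fact
  have finU: "finite U" and cardU: "card U = q ^ N"
    by (auto simp: U_def card_PiE intro!: finite_PiE)
  \<comment> \<open>A set outside the sigma-algebra has \<open>measure\<close> 0, below 2/3.\<close>
  have "E u j \<in> events" if "u \<in> U" "j < N" for u j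
    using prob[OF that] measure_notin_sets[of "E u j" P] by force
  then obtain \<omega> where \<omega>: "\<omega> \<in> space P"
    and "2 / 3 * card (U \<times> {..<N}) \<le> (\<Sum>(u, j)\<in>U \<times> {..<N}. indicator (E u j) \<omega> :: real)"
    using exists_many_events[of "U \<times> {..<N}" "\<lambda>(u, j). E u j" "2 / 3"] finU prob
    by (auto simp: case_prod_unfold)
  then have many: "2 / 3 * (real q ^ N * N) \<le> (\<Sum>u\<in>U. \<Sum>j<N. indicator (E u j) \<omega> :: real)"
    using finU cardU by (simp add: card_cartesian_product sum.cartesian_product)
  \<comment> \<open>By \<open>decode\<close>, all successful \<open>u\<close> with state
    \<open>m\<close> share the same symbol at \<open>j\<close>, so the choice is forced whenever one
    exists.\<close>
  define dec where "dec j m = (SOME k. \<exists>u\<in>U. mem \<omega> u = m \<and> \<omega> \<in> E u j \<and> u j = k)" for j m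
  have dec: "dec j (mem \<omega> u) = u j" if "u \<in> U" "j < N" "\<omega> \<in> E u j" for u j
    unfolding dec_def using that decode \<omega> by (intro some_equality) blast+
  define agree where "agree m u = card {j\<in>{..<N}. u j = dec j m}" for m u
  have agree: "(\<Sum>j<N. indicator (E u j) \<omega> :: real) \<le> agree (mem \<omega> u) u" if "u \<in> U" for u
  proof -
    have "(\<Sum>j<N. indicator (E u j) \<omega> :: real) \<le> (\<Sum>j<N. if u j = dec j (mem \<omega> u) then 1 else 0)"
      using dec[OF that] by (intro sum_mono) (auto simp: indicator_def)
    also have "\<dots> = agree (mem \<omega> u) u"
      by (simp add: agree_def sum.If_cases Int_def)
    finally show ?thesis .
  qed
  have fixed: "(\<Sum>u\<in>U. real q ^ agree m u) \<le> (2 * real q) ^ N" for m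
  proof -
    have "real q ^ agree m u = (\<Prod>j<N. if u j = dec j m then real q else 1)" for u
      by (simp add: agree_def prod.If_cases Int_def)
    then have "(\<Sum>u\<in>U. real q ^ agree m u) = (\<Prod>j<N. \<Sum>y<q. if y = dec j m then real q else 1)"
      unfolding U_def by (subst prod_sum_PiE) auto
    also have "\<dots> \<le> (\<Prod>j<N. 2 * real q)"
    proof (intro prod_mono conjI)
      fix j
      \<comment> \<open>At most one symbol weighs \<open>q\<close>, the others 1. A default value of
        \<open>dec j m\<close> outside the alphabet does no harm.\<close>
      have "(\<Sum>y<q. if y = dec j m then real q else 1) \<le> (\<Sum>y<q. (if y = dec j m then real q else 0) + 1)"
        by (intro sum_mono) auto
      also have "\<dots> \<le> 2 * real q" by (simp add: sum.distrib)
      finally show "(\<Sum>y<q. if y = dec j m then real q else 1) \<le> 2 * real q" .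
    qed (auto intro: sum_nonneg)
    finally show ?thesis by simp
  qed
  have "real q ^ N * real q powr (2 / 3 * N) \<le> (\<Sum>u\<in>U. real q ^ agree (mem \<omega> u) u)"
  proof -
    let ?k = "\<lambda>u. real (agree (mem \<omega> u) u) - 2 / 3 * N"
    have "(\<Sum>u\<in>U. \<Sum>j<N. indicator (E u j) \<omega> :: real) \<le> (\<Sum>u\<in>U. real (agree (mem \<omega> u) u))"
      by (intro sum_mono agree)
    with many have "2 / 3 * (real q ^ N * N) \<le> (\<Sum>u\<in>U. real (agree (mem \<omega> u) u))"
      by linarith
    then have "0 \<le> (\<Sum>u\<in>U. ?k u)"
      by (simp add: sum_subtractf cardU)
    then have "0 \<le> (\<Sum>u\<in>U. ?k u) * ln q"
      using \<open>0 < q\<close> by (intro mult_nonneg_nonneg) auto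
    then have "real q ^ N \<le> (\<Sum>u\<in>U. 1 + ?k u * ln q)"
      by (simp add: sum.distrib cardU sum_distrib_right)
    also have "\<dots> \<le> (\<Sum>u\<in>U. exp (?k u * ln q))"
      by (intro sum_mono exp_ge_add_one_self)
    also have "\<dots> = (\<Sum>u\<in>U. real q powr ?k u)"
      using \<open>0 < q\<close> by (simp add: powr_def)
    finally have "real q ^ N * real q powr (2 / 3 * N)
        \<le> (\<Sum>u\<in>U. real q powr ?k u) * real q powr (2 / 3 * N)"
      by (intro mult_right_mono) auto
    also have "\<dots> = (\<Sum>u\<in>U. real q ^ agree (mem \<omega> u) u)"
      using \<open>0 < q\<close> by (auto simp: sum_distrib_right powr_realpow simp flip: powr_add intro!: sum.cong)
    finally show ?thesis .
  qed
  \<comment> \<open>Summing over all states instead of the actual one decouples \<open>m\<close>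
    from \<open>u\<close>, at the price of a factor \<open>card S\<close>.\<close>
  also have "\<dots> \<le> (\<Sum>u\<in>U. \<Sum>m\<in>S. real q ^ agree m u)"
    using mem[OF \<omega>] \<open>finite S\<close> by (intro sum_mono member_le_sum) auto
  also have "\<dots> = (\<Sum>m\<in>S. \<Sum>u\<in>U. real q ^ agree m u)"
    by (rule sum.swap)
  also have "\<dots> \<le> (\<Sum>m\<in>S. (2 * real q) ^ N)"
    by (intro sum_mono fixed)
  also have "\<dots> = real q ^ N * (real (card S) * 2 ^ N)"
    by (simp add: power_mult_distrib)
  finally show ?thesis
    using \<open>0 < q\<close> by simp
qed

text \<open>Since \<open>64 powr (2 / 3 * N) = 2 ^ (4 * N)\<close> and there are at most
  \<open>2 ^ (s + 1)\<close> states, \<open>3 * N \<le> s + 1\<close>; for positive \<open>N\<close>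
  this gives two bits per symbol.\<close>

lemma index_lower_bound_bits:
  fixes N s :: nat and E :: "(nat \<Rightarrow> nat) \<Rightarrow> nat \<Rightarrow> 'w set" and mem :: "'w \<Rightarrow> (nat \<Rightarrow> nat) \<Rightarrow> bool list"
  defines "U \<equiv> {..<N} \<rightarrow>\<^sub>E {..<64}"
  assumes "prob_space P" and "0 < N"
    and "\<And>u j. u \<in> U \<Longrightarrow> j < N \<Longrightarrow> 2 / 3 \<le> measure P (E u j)"
    and mem: "\<And>\<omega> u. \<omega> \<in> space P \<Longrightarrow> u \<in> U \<Longrightarrow> length (mem \<omega> u) \<le> s"
    and "\<And>\<omega> u u' j. \<omega> \<in> E u j \<Longrightarrow> \<omega> \<in> E u' j \<Longrightarrow> \<omega> \<in> space P \<Longrightarrow> u \<in> U \<Longrightarrow> u' \<in> U \<Longrightarrow>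
        j < N \<Longrightarrow> mem \<omega> u = mem \<omega> u' \<Longrightarrow> u j = u' j"
  shows "2 * N \<le> s"
proof -
  have "real 64 powr (2 / 3 * N) \<le> real (card {m :: bool list. length m \<le> s}) * 2 ^ N"
    using assms finite_bool_lists[of s] unfolding U_def
    by (intro index_lower_bound[where E=E and mem=mem and P=P]) auto
  also have "\<dots> \<le> real (2 ^ (s + 1)) * 2 ^ N"
    using card_bool_lists_le[of s] by (intro mult_right_mono) (simp_all only: of_nat_le_iff, auto)
  also have "\<dots> = 2 ^ (s + 1 + N)"
    by (simp add: power_add)
  finally have "real 64 powr (2 / 3 * N) \<le> 2 ^ (s + 1 + N)" .
  moreover have "real 64 powr (2 / 3 * N) = 2 ^ (4 * N)"
  proof -
    have "real 64 = 2 powr 6" by simp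
    then have "real 64 powr (2 / 3 * N) = 2 powr (6 * (2 / 3 * N))"
      by (simp only: powr_powr)
    also have "6 * (2 / 3 * real N) = real (4 * N)" by simp
    finally show ?thesis by (simp only: powr_realpow)
  qed
  ultimately have "4 * N \<le> s + 1 + N"
    by (simp add: power_increasing_iff[of 2 "4 * N" "s + 1 + N", simplified])
  with \<open>0 < N\<close> show ?thesis by linarith
qed

section \<open>The hard regression instances\<close>

text \<open>Rows after Bob's are zero, as are their right-hand sides: they pad the stream to exactly
  \<open>n\<close> rows and have residual 0 for every solution vector.\<close>

definition index_matrix :: "nat \<Rightarrow> nat \<Rightarrow> nat \<Rightarrow> (nat \<Rightarrow> nat set) \<Rightarrow> nat \<Rightarrow> real mat" where
  "index_matrix n d N v j = Matrix.mat n d (\<lambda>(i, k).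
     if i < N then sign_vec d (v i) $ k
     else if i = N then sign_vec d (v j) $ k else 0)"

definition index_rhs :: "nat \<Rightarrow> nat \<Rightarrow> (nat \<Rightarrow> nat) \<Rightarrow> real vec" where
  "index_rhs n N u = Matrix.vec n (\<lambda>i. if i < N then real (u i) else if i = N then 448 else 0)"

lemma index_matrix_carrier [simp]: "index_matrix n d N v j \<in> carrier_mat n d"
  by (simp add: index_matrix_def)

lemma index_rhs_carrier [simp]: "index_rhs n N u \<in> carrier_vec n"
  by (simp add: index_rhs_def)

lemma row_index_matrix:
  "i < n \<Longrightarrow> row (index_matrix n d N v j) i =
     (if i < N then sign_vec d (v i) else if i = N then sign_vec d (v j) else 0\<^sub>v d)"
  by (auto simp: index_matrix_def intro!: eq_vecI)

lemma index_rhs_nth: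
  "i < n \<Longrightarrow> index_rhs n N u $ i = (if i < N then real (u i) else if i = N then 448 else 0)"
  by (simp add: index_rhs_def)

lemma index_regression_inputs:
  assumes D: "real_of_int ` {- 448..448} \<subseteq> D" and u: "\<And>i. i < N \<Longrightarrow> u i < 64"
  shows "(index_matrix n d N v j, index_rhs n N u) \<in> regression_inputs D n d"
proof -
  have in_D: "r \<in> D" if "r = real_of_int k" "\<bar>k\<bar> \<le> 448" for r k
    using that D by (auto intro!: subsetD[OF D] imageI)
  have "1 \<in> D" "- 1 \<in> D" "0 \<in> D" "448 \<in> D"
    by (auto intro: in_D[of _ 1] in_D[of _ "-1"] in_D[of _ 0] in_D[of _ 448])
  moreover have "real (u i) \<in> D" if "i < N" for i
    using u[OF that] by (intro in_D[of _ "int (u i)"]) auto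
  ultimately show ?thesis
    by (auto simp: regression_inputs_def elements_mat_def index_matrix_def index_rhs_def
        sign_vec_def vec_set_def)
qed

lemma index_regression_approx:
  assumes "0 < d" "N < n" "j < N" "0 \<le> \<epsilon>"
    and v: "\<And>i. i < N \<Longrightarrow> v i \<subseteq> {..<d}"
    and bal: "\<And>i. i < N \<Longrightarrow> i \<noteq> j \<Longrightarrow>
      d \<le> 4 * card (sym_diff (v i) (v j)) \<and> 4 * card (sym_diff (v i) (v j)) \<le> 3 * d"
    and u: "\<And>i. i < N \<Longrightarrow> u i < 64"
    and x: "linf_regression_approx \<epsilon> (index_matrix n d N v j) (index_rhs n N u) x"
  shows "\<bar>sign_vec d (v j) \<bullet> x - (448 + real (u j)) / 2\<bar> \<le> \<epsilon> * 448"
proof -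
  \<comment> \<open>The midpoint between the conflicting demands \<open>u j\<close> and 448 on the
    inner product with the vector of index \<open>j\<close>.\<close>
  define t where "t = (448 + real (u j)) / 2"
  define z where "z = (t / d) \<cdot>\<^sub>v sign_vec d (v j)"
  have self: "sign_vec d (v j) \<bullet> z = t"
    using v[of j] assms by (simp add: z_def scalar_prod_sign_vec)
  have cross: "\<bar>sign_vec d (v i) \<bullet> z\<bar> \<le> t / 2" if "i < N" "i \<noteq> j" for i
  proof -
    have "real d \<le> 4 * real (card (sym_diff (v i) (v j)))"
      "4 * real (card (sym_diff (v i) (v j))) \<le> 3 * real d"
      using bal[OF that] by linarith+
    then have "\<bar>sign_vec d (v i) \<bullet> sign_vec d (v j)\<bar> \<le> d / 2"
      unfolding scalar_prod_sign_vec[OF v[OF that(1)] v[OF \<open>j < N\<close>]] by linarith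
    then have "t / d * \<bar>sign_vec d (v i) \<bullet> sign_vec d (v j)\<bar> \<le> t / d * (d / 2)"
      by (intro mult_left_mono) (auto simp: t_def)
    then show ?thesis
      using \<open>0 < d\<close> by (simp add: z_def abs_mult t_def)
  qed
  have res: "\<bar>row (index_matrix n d N v j) i \<bullet> x - index_rhs n N u $ i\<bar>
      \<le> (448 - real (u j)) / 2 + \<epsilon> * 448" if "i < n" for i
  proof (rule linf_regression_approx_residual[OF index_matrix_carrier index_rhs_carrier \<open>0 \<le> \<epsilon>\<close> _ _ _ x that])
    show "z \<in> carrier_vec d" by (simp add: z_def)
    show "\<bar>row (index_matrix n d N v j) i \<bullet> z - index_rhs n N u $ i\<bar>
        \<le> (448 - real (u j)) / 2" if "i < n" for i
    proof -
      have uj: "real (u j) \<le> 63" using u[OF \<open>j < N\<close>] by simp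
      consider "i < N" "i = j" | "i < N" "i \<noteq> j" | "i = N" | "N < i" by linarith
      then show ?thesis
      proof cases
        case 2
        have "real (u i) \<le> 63" using u[OF 2(1)] by simp
        \<comment> \<open>By \<open>cross\<close> the left side is at most
          \<open>(448 + u j) / 4 + 63\<close>. For \<open>u j \<le> 63\<close> this needs a value of
          Bob of at least \<open>3 * 63 + 252 = 441\<close>; 448 is the next multiple of 64.\<close>
        then have "\<bar>sign_vec d (v i) \<bullet> z - real (u i)\<bar> \<le> (448 - real (u j)) / 2"
          using cross[OF 2] uj unfolding t_def abs_le_iff by (auto simp: field_simps)
        then show ?thesis
          using 2 that by (simp add: row_index_matrix index_rhs_nth)
      next
        case 1
        have "\<bar>t - real (u j)\<bar> \<le> (448 - real (u j)) / 2"
          using uj by (simp add: t_def abs_le_iff field_simps)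
        then show ?thesis
          using 1 that self by (simp add: row_index_matrix index_rhs_nth)
      next
        case 3
        have "\<bar>t - 448\<bar> \<le> (448 - real (u j)) / 2"
          using uj by (simp add: t_def abs_le_iff field_simps)
        then show ?thesis
          using 3 that self by (simp add: row_index_matrix index_rhs_nth)
      next
        case 4
        then show ?thesis
          using that uj by (simp add: row_index_matrix index_rhs_nth z_def)
      qed
    qed
    show "\<bar>index_rhs n N u $ i\<bar> \<le> 448" if "i < n" for i
      using that u[of i] by (auto simp: index_rhs_nth)
  qed
  \<comment> \<open>Row \<open>j\<close> bounds the inner product from above and row
    \<open>N\<close> from below; both bounds are centred at \<open>t\<close>.\<close>
  have "\<bar>sign_vec d (v j) \<bullet> x - real (u j)\<bar> \<le> (448 - real (u j)) / 2 + \<epsilon> * 448"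
    using res[of j] \<open>j < N\<close> \<open>N < n\<close> by (simp add: row_index_matrix index_rhs_nth)
  moreover have "\<bar>sign_vec d (v j) \<bullet> x - 448\<bar> \<le> (448 - real (u j)) / 2 + \<epsilon> * 448"
    using res[of N] \<open>N < n\<close> by (simp add: row_index_matrix index_rhs_nth)
  ultimately show ?thesis
    unfolding abs_le_iff by (auto simp: field_simps)
qed

section \<open>From INDEX to the space bound\<close>

lemma linf_regression_space_bound_code:
  assumes "prob_space P" "0 < d" "0 < N" "N < n" "0 \<le> \<epsilon>" "\<epsilon> \<le> 1 / 3584"
    and D: "real_of_int ` {- 448..448} \<subseteq> D"
    and solves: "solves_linf_regression P \<A> D n d \<epsilon>" and space: "space_at_most P \<A> D n d s"
    and v: "\<And>i. i < N \<Longrightarrow> v i \<subseteq> {..<d}"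
    and bal: "\<And>i j. i < N \<Longrightarrow> j < N \<Longrightarrow> i \<noteq> j \<Longrightarrow>
      d \<le> 4 * card (sym_diff (v i) (v j)) \<and> 4 * card (sym_diff (v i) (v j)) \<le> 3 * d"
  shows "2 * N \<le> s"
proof -
  \<comment> \<open>Bob's index 0 is a placeholder: after \<open>N\<close> steps his row has not
    been read, so any index gives the same state.\<close>
  define mem where "mem \<omega> u = memory_after \<A> \<omega> (index_matrix n d N v 0) (index_rhs n N u) N" for \<omega> u
  define E where "E u j = {\<omega>\<in>space P. linf_regression_approx \<epsilon> (index_matrix n d N v j) (index_rhs n N u)
      (run \<A> \<omega> (index_matrix n d N v j) (index_rhs n N u))}" for u j
  have mem_eq: "memory_after \<A> \<omega> (index_matrix n d N v j) (index_rhs n N u) N = mem \<omega> u" for \<omega> j u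
    unfolding mem_def using \<open>N < n\<close>
    by (intro memory_after_cong_prefix) (auto simp: row_index_matrix)
  have inp: "(index_matrix n d N v j, index_rhs n N u) \<in> regression_inputs D n d"
    if "u \<in> {..<N} \<rightarrow>\<^sub>E {..<64}" for u j
    using that by (intro index_regression_inputs D) auto
  show ?thesis
  proof (rule index_lower_bound_bits[where E=E and mem=mem, OF \<open>prob_space P\<close> \<open>0 < N\<close>])
    show "2 / 3 \<le> measure P (E u j)" if "u \<in> {..<N} \<rightarrow>\<^sub>E {..<64}" for u j
      using solves inp[OF that] unfolding solves_linf_regression_def E_def by blast
    show "length (mem \<omega> u) \<le> s" if "\<omega> \<in> space P" "u \<in> {..<N} \<rightarrow>\<^sub>E {..<64}" for \<omega> u
      using space inp[OF that(2), of 0] that(1) \<open>N < n\<close> unfolding space_at_most_def mem_def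
      by fastforce
    fix \<omega> u u' j
    assume *: "\<omega> \<in> E u j" "\<omega> \<in> E u' j" "u \<in> {..<N} \<rightarrow>\<^sub>E {..<64}" "u' \<in> {..<N} \<rightarrow>\<^sub>E {..<64}"
      "j < N" "mem \<omega> u = mem \<omega> u'"
    let ?x = "\<lambda>u. run \<A> \<omega> (index_matrix n d N v j) (index_rhs n N u)"
    have "memory_after \<A> \<omega> (index_matrix n d N v j) (index_rhs n N u) n =
        memory_after \<A> \<omega> (index_matrix n d N v j) (index_rhs n N u') n"
    proof (rule memory_after_cong_suffix[where m=N])
    qed (use *(6) \<open>N < n\<close> in \<open>auto simp: mem_eq index_rhs_nth\<close>)
    then have same: "?x u = ?x u'"
      by (simp add: run_def index_matrix_def)
    have "\<bar>sign_vec d (v j) \<bullet> ?x w - (448 + real (w j)) / 2\<bar> \<le> \<epsilon> * 448" if "w = u \<or> w = u'" for w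
      using * that assms by (intro index_regression_approx[where N=N and n=n and v=v]) (auto simp: E_def)
    \<comment> \<open>The answer reveals half of \<open>u j\<close> up to
      \<open>\<epsilon> * 448\<close>, so two candidates differ by at most
      \<open>4 * (\<epsilon> * 448)\<close>. For \<open>\<epsilon> \<le> 1 / (8 * 448)\<close> this
      is at most 1/2, hence the symbols agree.\<close>
    from this[of u] this[of u'] have "\<bar>real (u j) - real (u' j)\<bar> \<le> 4 * (\<epsilon> * 448)"
      unfolding same abs_le_iff by (auto simp: field_simps)
    also have "\<dots> < 1" using assms by simp
    finally show "u j = u' j" by linarith
  qed
qed

text \<open>With \<open>n = 1\<close> there is no room for Bob's row. A single equation is solvable
  exactly, so the optimum is 0 and the answer itself reveals the one symbol.\<close>

lemma linf_regression_space_bound_single_row: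
  assumes "prob_space P" "0 < d" "0 \<le> \<epsilon>" "\<epsilon> \<le> 1 / 3584"
    and D: "real_of_int ` {- 448..448} \<subseteq> D"
    and solves: "solves_linf_regression P \<A> D 1 d \<epsilon>" and space: "space_at_most P \<A> D 1 d s"
  shows "2 \<le> s"
proof -
  define v where "v = (\<lambda>i::nat. {..<d})"
  define mem where "mem \<omega> u = memory_after \<A> \<omega> (index_matrix 1 d 1 v 0) (index_rhs 1 1 u) 1" for \<omega> u
  define E where "E u j = {\<omega>\<in>space P. linf_regression_approx \<epsilon> (index_matrix 1 d 1 v 0) (index_rhs 1 1 u)
      (run \<A> \<omega> (index_matrix 1 d 1 v 0) (index_rhs 1 1 u))}" for u and j :: nat
  have inp: "(index_matrix 1 d 1 v 0, index_rhs 1 1 u) \<in> regression_inputs D 1 d"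
    if "u \<in> {..<1} \<rightarrow>\<^sub>E {..<64}" for u
    using that by (intro index_regression_inputs D) auto
  have "2 * 1 \<le> s"
  proof (rule index_lower_bound_bits[where E=E and mem=mem and N=1, OF \<open>prob_space P\<close>])
    show "2 / 3 \<le> measure P (E u j)" if "u \<in> {..<1} \<rightarrow>\<^sub>E {..<64}" for u j
      using solves inp[OF that] unfolding solves_linf_regression_def E_def by blast
    show "length (mem \<omega> u) \<le> s" if "\<omega> \<in> space P" "u \<in> {..<1} \<rightarrow>\<^sub>E {..<64}" for \<omega> u
      using space inp[OF that(2)] that(1) unfolding space_at_most_def mem_def by fastforce
    fix \<omega> u u' j
    assume *: "\<omega> \<in> E u j" "\<omega> \<in> E u' j" "u \<in> {..<1} \<rightarrow>\<^sub>E {..<64}" "u' \<in> {..<1} \<rightarrow>\<^sub>E {..<64}"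
      "j < 1" "mem \<omega> u = mem \<omega> u'"
    let ?x = "\<lambda>u. run \<A> \<omega> (index_matrix 1 d 1 v 0) (index_rhs 1 1 u)"
    have same: "?x u = ?x u'"
      using *(6) by (simp add: run_def mem_def index_matrix_def)
    have "\<bar>sign_vec d {..<d} \<bullet> ?x w - real (w 0)\<bar> \<le> \<epsilon> * 448" if w: "w = u \<or> w = u'" for w
    proof -
      have "\<bar>row (index_matrix 1 d 1 v 0) 0 \<bullet> ?x w - index_rhs 1 1 w $ 0\<bar> \<le> 0 + \<epsilon> * 448"
      proof (rule linf_regression_approx_residual[OF index_matrix_carrier index_rhs_carrier \<open>0 \<le> \<epsilon>\<close>])
        show "(real (w 0) / d) \<cdot>\<^sub>v sign_vec d {..<d} \<in> carrier_vec d" by simp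
        show "\<bar>row (index_matrix 1 d 1 v 0) i \<bullet> ((real (w 0) / d) \<cdot>\<^sub>v sign_vec d {..<d})
            - index_rhs 1 1 w $ i\<bar> \<le> 0" if "i < 1" for i
          using that \<open>0 < d\<close> by (simp add: row_index_matrix index_rhs_nth v_def scalar_prod_sign_vec)
        have "w 0 < 64" using * w by auto
        then show "\<bar>index_rhs 1 1 w $ i\<bar> \<le> 448" if "i < 1" for i
          using that by (simp add: index_rhs_nth)
        show "linf_regression_approx \<epsilon> (index_matrix 1 d 1 v 0) (index_rhs 1 1 w) (?x w)"
          using * w by (auto simp: E_def)
      qed simp
      then show ?thesis by (simp add: row_index_matrix index_rhs_nth v_def)
    qed
    from this[of u] this[of u'] have "\<bar>real (u 0) - real (u' 0)\<bar> \<le> 2 * (\<epsilon> * 448)"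
      unfolding same abs_le_iff by (auto simp: field_simps)
    also have "\<dots> < 1" using assms by simp
    finally show "u j = u' j" using \<open>j < 1\<close> by simp
  qed simp
  then show ?thesis by simp
qed

text \<open>One row is reserved for Bob, so \<open>N = min (n - 1) (card C)\<close>. The bound
  \<open>2 * N\<close> absorbs both losses: \<open>n \<le> 2 * (n - 1)\<close> for
  \<open>n \<ge> 2\<close>, and the code has at least half of \<open>2 powr (d / 8)\<close>
  words.\<close>

lemma linf_regression_space_bound:
  assumes "prob_space P" "0 < d" "0 < n" "0 \<le> \<epsilon>" "\<epsilon> \<le> 1 / 3584"
    and D: "real_of_int ` {- 448..448} \<subseteq> D"
    and solves: "solves_linf_regression P \<A> D n d \<epsilon>" and space: "space_at_most P \<A> D n d s"
  shows "min (real n) (2 powr (1 / 8 * real d)) \<le> real s"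
proof (cases "n = 1")
  case True
  then show ?thesis
    using linf_regression_space_bound_single_row[of P d \<epsilon> D \<A> s] assms by auto
next
  case False
  obtain C where C: "C \<subseteq> Pow {..<d}" "2 powr (real d / 8) \<le> 2 * card C"
    and bal: "\<forall>X\<in>C. \<forall>Y\<in>C. X \<noteq> Y \<longrightarrow>
      d \<le> 4 * card (sym_diff X Y) \<and> 4 * card (sym_diff X Y) \<le> 3 * d"
    using exists_balanced_code[of d] by blast
  have "finite C" using C by (auto intro: finite_subset)
  then obtain v where v: "bij_betw v {0..<card C} C"
    using ex_bij_betw_nat_finite by blast
  have "0 < (2::real) powr (real d / 8)" by simp
  with C(2) have "0 < card C" by (cases "card C = 0") auto
  define N where "N = min (n - 1) (card C)"
  have v_in: "v i \<in> C" if "i < N" for i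
    using v that by (auto simp: N_def bij_betw_def)
  have v_neq: "v i \<noteq> v j" if "i < N" "j < N" "i \<noteq> j" for i j
    using v that by (auto simp: N_def bij_betw_def inj_on_def)
  have "2 * N \<le> s"
  proof (rule linf_regression_space_bound_code[OF \<open>prob_space P\<close> \<open>0 < d\<close> _ _ \<open>0 \<le> \<epsilon>\<close> \<open>\<epsilon> \<le> 1 / 3584\<close> D solves space])
    show "0 < N" "N < n"
      using False \<open>0 < n\<close> \<open>0 < card C\<close> by (auto simp: N_def)
    show "v i \<subseteq> {..<d}" if "i < N" for i
      using v_in[OF that] C by auto
    show "d \<le> 4 * card (sym_diff (v i) (v j)) \<and> 4 * card (sym_diff (v i) (v j)) \<le> 3 * d"
      if "i < N" "j < N" "i \<noteq> j" for i j
      using bal v_in[OF that(1)] v_in[OF that(2)] v_neq[OF that] by blast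
  qed
  moreover have "n \<le> 2 * (n - 1)" using False \<open>0 < n\<close> by linarith
  ultimately have "real n \<le> s \<or> 2 * real (card C) \<le> s"
    by (auto simp: N_def min_def split: if_splits)
  with C(2) show ?thesis by auto
qed

theorem theorem7:
  shows "\<exists>\<epsilon>\<^sub>0>0. \<exists>c>0. \<exists>K::nat. \<forall>\<epsilon>::real. 0 < \<epsilon> \<and> \<epsilon> \<le> \<epsilon>\<^sub>0 \<longrightarrow>
    (\<forall>(D::real set) (n::nat) (d::nat) (P::tape measure) (\<A>::streaming_alg) (s::nat).
       real_of_int ` {- int K..int K} \<subseteq> D \<and> n \<ge> 1 \<and> d \<ge> 1 \<and> prob_space P \<and>
       solves_linf_regression P \<A> D n d \<epsilon> \<and> space_at_most P \<A> D n d s \<longrightarrow>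
       real s \<ge> min (real n) (2 powr (c * real d)))"
\<comment> \<open>The witnesses are the decoding accuracy \<open>1 / (8 * 448)\<close>, the rate of
  the code, and the largest entry of the hard instances.\<close>
proof (rule exI[of _ "1 / 3584"], rule conjI, simp, rule exI[of _ "1 / 8"], rule conjI, simp,
    rule exI[of _ 448], intro allI impI, elim conjE)
qed (rule linf_regression_space_bound; simp)

end
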